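(* Let $0\le a<b<\infty$, let $l\ge 1$ be a real number, and let $p,q>0$ be real numbers. Let $f:[a,b]\to\mathbb{R}$ be continuous on $[a,b]$ with $f\in L([a,b])$. If $|f|^{l}$ is quasi-convex on $[a,b]$, then $$\int_a^b (x-a)^p(b-x)^q f(x)\,dx\le (b-a)^{p+q+1}\beta(p+1,q+1)\left(\max\left\{|f(a)|^{l},|f(b)|^{l}\right\}\right)^{\frac1l}.$$
   Context: A function $g:[a,b]\to\mathbb{R}$ is quasi-convex on $[a,b]$ if $g(\lambda x+(1-\lambda)y)\le\max\{g(x),g(y)\}$ for all $x,y\in[a,b]$ and $\lambda\in[0,1]$. $L([a,b])$ denotes the integrable functions on $[a,b]$. $\beta(x,y)=\int_0^1 t^{x-1}(1-t)^{y-1}\,dt$ ($x,y>0$) is the Euler Beta function. *)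

theory Defs
  imports "HOL-Analysis.Analysis"
begin

definition quasi_convex_on :: "real set \<Rightarrow> (real \<Rightarrow> real) \<Rightarrow> bool" where
  "quasi_convex_on S g \<longleftrightarrow>
     (\<forall>x\<in>S. \<forall>y\<in>S. \<forall>t\<in>{0..1}. g (t * x + (1 - t) * y) \<le> max (g x) (g y))"

text \<open>The library defines \<^const>\<open>Beta\<close> through the Gamma function; for positive
  arguments it is Euler's integral.\<close>

lemma Beta_eq_Euler_integral:
  fixes x y :: real
  assumes "x > 0" "y > 0"
  shows "Beta x y = integral {0..1} (\<lambda>t. t powr (x - 1) * (1 - t) powr (y - 1))"
  using has_integral_Beta_real[OF assms] by (simp add: integral_unique)

end

theory Submission
  imports Defs
begin

text \<open>A quasi-convex function on an interval is bounded by the larger of its endpoint values,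
  so \<open>\<bar>f x\<bar> powr l\<close> never exceeds
  \<open>max (\<bar>f a\<bar> powr l) (\<bar>f b\<bar> powr l)\<close>. Taking \<open>l\<close>-th
  roots bounds \<open>f\<close> by a constant. The weight
  \<open>(x - a) powr p * (b - x) powr q\<close> is nonnegative, so the integral is at most that
  constant times the integral of the weight, which \<open>has_integral_Beta_interval\<close>
  evaluates by rescaling Euler's integral.\<close>

lemma has_integral_Beta_interval:
  fixes a b p q :: real
  assumes "a < b" "p > 0" "q > 0"
  shows "((\<lambda>x. (x - a) powr (p - 1) * (b - x) powr (q - 1)) has_integral
           (b - a) powr (p + q - 1) * Beta p q) {a..b}"
proof -
  define d where "d = b - a"
  have d: "d > 0" using assms by (simp add: d_def)
  define g where "g = (\<lambda>t::real. t powr (p - 1) * (1 - t) powr (q - 1))"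
  have "(g has_integral Beta p q) (cbox 0 1)"
    using has_integral_Beta_real[of p q] assms by (simp add: g_def)
  \<comment> \<open>Substitution \<open>t = (x - a) / d\<close>, whose Jacobian contributes the
    factor \<open>d\<close>.\<close>
  from has_integral_affinity[OF this, of "1 / d" "- a / d"]
  have "((\<lambda>x. g ((x - a) / d)) has_integral d * Beta p q)
      ((\<lambda>x. d * x + a) ` {0..1})"
    using d by (simp add: diff_divide_distrib)
  moreover have "(\<lambda>x. d * x + a) ` {0..1} = {a..b}"
    using d by (simp add: image_affinity_atLeastAtMost d_def)
  \<comment> \<open>The factor \<open>d powr (p + q - 2)\<close> clears the denominators
    \<open>d powr (p - 1)\<close> and \<open>d powr (q - 1)\<close> in the rescaled
    integrand.\<close>
  ultimately have int: "((\<lambda>x. d powr (p + q - 2) * g ((x - a) / d)) has_integral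
      d powr (p + q - 2) * (d * Beta p q)) {a..b}"
    using has_integral_mult_right[of "\<lambda>x. g ((x - a) / d)" _ "{a..b}" "d powr (p + q - 2)"]
    by simp
  have value_eq: "d powr (p + q - 2) * (d * Beta p q) = d powr (p + q - 1) * Beta p q"
    using d powr_mult_base[of d "p + q - 2"] by (simp add: algebra_simps)
  have "d powr (p + q - 2) * g ((x - a) / d)
      = (x - a) powr (p - 1) * (b - x) powr (q - 1)" if "x \<in> {a..b}" for x
  proof -
    have "1 - (x - a) / d = (b - x) / d"
      using d by (simp add: d_def field_simps)
    moreover have "d powr (p + q - 2) = d powr (p - 1) * d powr (q - 1)"
      by (simp flip: powr_add)
    ultimately show ?thesis
      using d that by (simp add: g_def powr_divide)
  qed
  from has_integral_eq[OF this int] show ?thesis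
    unfolding value_eq by (simp add: d_def)
qed

text \<open>Each point of the interval is a convex combination of the two endpoints; when
  \<open>a < b\<close> fails, the only possible point is \<open>a\<close> itself.\<close>

lemma quasi_convex_on_interval_le_max:
  assumes "quasi_convex_on {a..b} g" "x \<in> {a..b}"
  shows "g x \<le> max (g a) (g b)"
proof (cases "a < b")
  case True
  define t where "t = (b - x) / (b - a)"
  have "t \<in> {0..1}"
    using True assms(2) by (simp add: t_def)
  moreover have "t * a + (1 - t) * b = x"
  proof -
    have "t * (b - a) = b - x"
      using True by (simp add: t_def)
    then show ?thesis by (simp add: algebra_simps)
  qed
  ultimately show ?thesis
    using assms True unfolding quasi_convex_on_def by force
next
  case False
  then have "x = a"
    using assms(2) by simp
  then show ?thesis by simp
qed

theorem theorem3p2: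
  fixes a b l p q :: real and f :: "real \<Rightarrow> real"
  assumes "0 \<le> a" and "a < b" and "l \<ge> 1" and "p > 0" and "q > 0"
    and "continuous_on {a..b} f"
    and "f absolutely_integrable_on {a..b}"
    and "quasi_convex_on {a..b} (\<lambda>x. \<bar>f x\<bar> powr l)"
  shows "integral {a..b} (\<lambda>x. (x - a) powr p * (b - x) powr q * f x)
    \<le> (b - a) powr (p + q + 1) * Beta (p + 1) (q + 1)
        * (max (\<bar>f a\<bar> powr l) (\<bar>f b\<bar> powr l)) powr (1 / l)"
    (is "_ \<le> ?B * ?M")
proof (rule has_integral_le)
  \<comment> \<open>Where a base vanishes, at an endpoint, \<open>powr\<close> is continuous because
    \<open>p\<close> and \<open>q\<close> are positive.\<close>
  have "continuous_on {a..b} (\<lambda>x. (x - a) powr p * (b - x) powr q * f x)"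
    using assms by (intro continuous_intros continuous_on_powr') auto
  then show "((\<lambda>x. (x - a) powr p * (b - x) powr q * f x) has_integral
      integral {a..b} (\<lambda>x. (x - a) powr p * (b - x) powr q * f x)) {a..b}"
    by (intro integrable_integral integrable_continuous_interval)
  have "((\<lambda>x. (x - a) powr p * (b - x) powr q) has_integral ?B) {a..b}"
    using has_integral_Beta_interval[of a b "p + 1" "q + 1"] assms by (simp add: add_ac)
  then show "((\<lambda>x. (x - a) powr p * (b - x) powr q * ?M) has_integral ?B * ?M) {a..b}"
    by (rule has_integral_mult_left)
  fix x assume x: "x \<in> {a..b}"
  \<comment> \<open>The right-hand side collapses to \<open>\<bar>f x\<bar>\<close>, since
    \<open>l * (1 / l) = 1\<close>.\<close>
  have "f x \<le> (\<bar>f x\<bar> powr l) powr (1 / l)"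
    using assms(3) by (simp add: powr_powr)
  also have "\<dots> \<le> ?M"
    using quasi_convex_on_interval_le_max[OF assms(8) x] assms(3)
    by (intro powr_mono2) auto
  finally show "(x - a) powr p * (b - x) powr q * f x \<le> (x - a) powr p * (b - x) powr q * ?M"
    by (intro mult_left_mono) auto
qed

end
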